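(* Let $K$ be a field, let $P=K[x_1,\dots,x_n]$ with homogeneous component $P_1$ of degree one, let $L=(\ell_1,\dots,\ell_r)$ be a tuple of $K$-linearly independent linear forms in $P$, let $I_L=\langle L\rangle$ be the ideal generated by $\ell_1,\dots,\ell_r$, and let $A=(a_{ij})\in\mathrm{Mat}_{r,n}(K)$ be the coefficient matrix of $L$. Moreover, let $1\le s\le r$, let $Z=(z_1,\dots,z_s)$ be a tuple of distinct indeterminates in $X=(x_1,\dots,x_n)$, and let $Y=X\setminus Z$. Then the following conditions are equivalent. (a) There exists a term ordering $\sigma$ such that $\langle Z\rangle\subseteq\mathrm{LT}_\sigma(I_L)$. (b) The residue classes of the elements of $Y$ generate the $K$-vector space $P_1/\langle L\rangle_K$. (c) Let $i_1,\dots,i_s\in\{1,\dots,n\}$ be the indices such that $z_j=x_{i_j}$ for $j=1,\dots,s$. Then the columns $i_1,\dots,i_s$ of $A$ are linearly independent.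
   Context: The coefficient matrix of $L=(\ell_1,\dots,\ell_r)$ is the matrix $A=(a_{ij})$ with $\ell_i=a_{i1}x_1+\cdots+a_{in}x_n$. $\langle L\rangle_K$ denotes the $K$-vector space spanned by $\ell_1,\dots,\ell_r$, $\langle Z\rangle$ the ideal of $P$ generated by $z_1,\dots,z_s$, and $\mathrm{LT}_\sigma(I_L)$ the leading term ideal of $I_L$ with respect to the term ordering $\sigma$. *)

theory Defs
  imports "HOL-Analysis.Cartesian_Space" "HOL-Library.Poly_Mapping"
begin

text \<open>
  Power products in the indeterminates \<open>x\<^sub>i\<close> (\<open>i :: 'n\<close>) are their exponent vectors, so the
  power product \<open>1\<close> is \<open>0\<close> and multiplication of power products is addition.
  For a finite type \<open>'n\<close> with \<open>n\<close> elements, \<open>('n, 'k) pol\<close> is \<open>K[x\<^sub>1, \<dots>, x\<^sub>n]\<close>.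
\<close>

type_synonym 'n power_product = "'n \<Rightarrow>\<^sub>0 nat"
type_synonym ('n, 'k) pol = "'n power_product \<Rightarrow>\<^sub>0 'k"

definition indet :: "'n \<Rightarrow> ('n, 'k::field) pol" where
  "indet i = Poly_Mapping.single (Poly_Mapping.single i 1) 1"

definition pol_scale :: "'k::field \<Rightarrow> ('n, 'k) pol \<Rightarrow> ('n, 'k) pol" where
  "pol_scale c p = Poly_Mapping.single 0 c * p"

global_interpretation pol: vector_space "pol_scale :: 'k::field \<Rightarrow> ('n, 'k) pol \<Rightarrow> _"
  by unfold_locales
    (simp_all add: pol_scale_def distrib_left distrib_right single_add mult_single
      flip: mult.assoc)

text \<open>Submodules of a commutative ring are its ideals: \<open>ideal.span S\<close> is the ideal generated by \<open>S\<close>.\<close>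

global_interpretation ideal: module "(*) :: 'a::comm_ring_1 \<Rightarrow> 'a \<Rightarrow> 'a"
  by unfold_locales (simp_all add: algebra_simps)

definition homogeneous_component :: "nat \<Rightarrow> ('n::finite, 'k::field) pol set" where
  "homogeneous_component d =
     {p. \<forall>t \<in> Poly_Mapping.keys p. (\<Sum>i\<in>UNIV. Poly_Mapping.lookup t i) = d}"

definition is_coefficient_matrix ::
    "'k::field ^ 'n::finite ^ 'r::finite \<Rightarrow> ('r \<Rightarrow> ('n, 'k) pol) \<Rightarrow> bool" where
  "is_coefficient_matrix A L \<longleftrightarrow> (\<forall>i. L i = (\<Sum>j\<in>UNIV. pol_scale (A $ i $ j) (indet j)))"

text \<open>\<open>(t, u) \<in> \<sigma>\<close> is read as \<open>t \<le>\<^sub>\<sigma> u\<close>.\<close>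

definition term_ordering :: "'n power_product rel \<Rightarrow> bool" where
  "term_ordering \<sigma> \<longleftrightarrow>
     linear_order \<sigma> \<and>
     (\<forall>t. (0, t) \<in> \<sigma>) \<and>
     (\<forall>t u v. (t, u) \<in> \<sigma> \<longrightarrow> (t + v, u + v) \<in> \<sigma>)"

text \<open>Only meaningful for \<open>f \<noteq> 0\<close>.\<close>

definition leading_term :: "'n power_product rel \<Rightarrow> ('n, 'k::field) pol \<Rightarrow> 'n power_product" where
  "leading_term \<sigma> f =
     (THE t. t \<in> Poly_Mapping.keys f \<and> (\<forall>u \<in> Poly_Mapping.keys f. (u, t) \<in> \<sigma>))"

definition leading_term_ideal ::
    "'n power_product rel \<Rightarrow> ('n, 'k::field) pol set \<Rightarrow> ('n, 'k) pol set" where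
  "leading_term_ideal \<sigma> I =
     ideal.span {Poly_Mapping.single (leading_term \<sigma> f) 1 | f. f \<in> I \<and> f \<noteq> 0}"

text \<open>
  The quotient space \<open>V/W\<close> for subspaces \<open>W \<subseteq> V\<close> of the polynomial ring. Its elements are the
  cosets of \<open>W\<close>, and its zero is \<open>W\<close> itself. In \<open>class_scale\<close>, adding \<open>W\<close> only matters for
  \<open>c = 0\<close>, where \<open>c C\<close> alone would be \<open>{0}\<close> instead of the zero coset.
\<close>

definition residue_class :: "('n, 'k::field) pol set \<Rightarrow> ('n, 'k) pol \<Rightarrow> ('n, 'k) pol set" where
  "residue_class W p = {p + w | w. w \<in> W}"

definition quotient_space ::
    "('n, 'k::field) pol set \<Rightarrow> ('n, 'k) pol set \<Rightarrow> ('n, 'k) pol set set" where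
  "quotient_space V W = residue_class W ` V"

definition class_add ::
    "('n, 'k::field) pol set \<Rightarrow> ('n, 'k) pol set \<Rightarrow> ('n, 'k) pol set" where
  "class_add C D = {p + q | p q. p \<in> C \<and> q \<in> D}"

definition class_scale ::
    "('n, 'k::field) pol set \<Rightarrow> 'k \<Rightarrow> ('n, 'k) pol set \<Rightarrow> ('n, 'k) pol set" where
  "class_scale W c C = {pol_scale c p + w | p w. p \<in> C \<and> w \<in> W}"

lemma residue_class_eq_iff:
  assumes "pol.subspace W"
  shows "residue_class W p = residue_class W q \<longleftrightarrow> p - q \<in> W"
proof
  assume eq: "residue_class W p = residue_class W q"
  have "p \<in> residue_class W p"
    using pol.subspace_0[OF assms] by (force simp: residue_class_def)
  then show "p - q \<in> W"
    unfolding eq by (auto simp: residue_class_def)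
next
  assume *: "p - q \<in> W"
  have "p + w = q + ((p - q) + w)" "q + w = p + (w - (p - q))" for w
    by simp_all
  then show "residue_class W p = residue_class W q"
    unfolding residue_class_def
    using pol.subspace_add[OF assms *] pol.subspace_diff[OF assms _ *] by blast
qed

lemma residue_class_zero: "residue_class W 0 = W"
  by (simp add: residue_class_def)

lemma class_add_residue_class:
  assumes "pol.subspace W"
  shows "class_add (residue_class W p) (residue_class W q) = residue_class W (p + q)"
proof -
  have "(p + v) + (q + w) = (p + q) + (v + w)" "(p + q) + w = (p + w) + (q + 0)" for v w
    by (simp_all add: algebra_simps)
  then show ?thesis
    unfolding class_add_def residue_class_def
    using pol.subspace_add[OF assms] pol.subspace_0[OF assms] by blast
qed

lemma class_scale_residue_class:
  assumes "pol.subspace W"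
  shows "class_scale W c (residue_class W p) = residue_class W (pol_scale c p)"
proof -
  have "pol_scale c (p + v) + w = pol_scale c p + (pol_scale c v + w)"
    "pol_scale c p + w = pol_scale c (p + 0) + w" for v w
    by (simp_all add: pol.scale_right_distrib add.assoc)
  then show ?thesis
    unfolding class_scale_def residue_class_def
    using pol.subspace_add[OF assms] pol.subspace_scale[OF assms] pol.subspace_0[OF assms]
    by blast
qed

text \<open>The subspace of a quotient modulo \<open>W\<close> generated by a set \<open>G\<close> of residue classes.\<close>

inductive_set quotient_span ::
    "('n, 'k::field) pol set \<Rightarrow> ('n, 'k) pol set set \<Rightarrow> ('n, 'k) pol set set"
  for W :: "('n, 'k) pol set" and G :: "('n, 'k) pol set set" where
  zero: "W \<in> quotient_span W G"
| gen: "C \<in> G \<Longrightarrow> C \<in> quotient_span W G"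
| add: "C \<in> quotient_span W G \<Longrightarrow> D \<in> quotient_span W G \<Longrightarrow> class_add C D \<in> quotient_span W G"
| scale: "C \<in> quotient_span W G \<Longrightarrow> class_scale W c C \<in> quotient_span W G"

end

theory Submission imports Defs begin

text \<open>
  Condition (b) says that every indeterminate lies in \<open>T = \<langle>L\<rangle>\<^sub>K + \<langle>Y\<rangle>\<^sub>K\<close>. Given (a), each \<open>z \<in> Z\<close> is the
  leading term of some \<open>f \<in> I\<^sub>L\<close>, whose linear part lies in \<open>\<langle>L\<rangle>\<^sub>K\<close> and writes \<open>z\<close> in terms of
  smaller indeterminates, so (b) follows by induction along \<open>\<sigma>\<close>. Given (b), each \<open>z \<in> Z\<close> has the
  form \<open>w + y\<close> with \<open>w \<in> \<langle>L\<rangle>\<^sub>K\<close> and \<open>y \<in> \<langle>Y\<rangle>\<^sub>K\<close>, and \<open>z\<close> is the leading term of \<open>w\<close> for an ordering that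
  makes \<open>Z\<close> larger than \<open>Y\<close>. Finally, (b) fails iff a nonzero linear functional on the linear forms
  vanishes on \<open>T\<close>, and such functionals are the linear dependencies of the columns in (c).
\<close>

section \<open>Linear independence of finite families\<close>

text \<open>Independence of \<open>range v\<close> does not see repeated vectors, so injectivity
  supplies the missing half of independence of the family. On an injective family, relations
  transfer along \<open>v\<close> and its inverse.\<close>

lemma (in vector_space) family_independent_iff:
  fixes v :: "'i::finite \<Rightarrow> 'b"
  shows "inj v \<and> independent (range v) \<longleftrightarrow>
    (\<forall>c. (\<Sum>j\<in>UNIV. scale (c j) (v j)) = 0 \<longrightarrow> (\<forall>j. c j = 0))"
proof (intro iffI conjI allI impI)
  fix c j
  assume *: "inj v \<and> independent (range v)" and "(\<Sum>j\<in>UNIV. scale (c j) (v j)) = 0"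
  then have "(\<Sum>x\<in>range v. scale (c (inv v x)) x) = 0"
    by (simp add: sum.reindex)
  then have "c (inv v (v j)) = 0"
    using * independentD[of "range v" "range v" "\<lambda>x. c (inv v x)" "v j"] by simp
  then show "c j = 0"
    using * by simp
next
  assume *: "\<forall>c. (\<Sum>j\<in>UNIV. scale (c j) (v j)) = 0 \<longrightarrow> (\<forall>j. c j = 0)"
  show inj: "inj v"
  proof (rule injI, rule ccontr)
    fix a b
    assume ab: "v a = v b" "a \<noteq> b"
    \<comment> \<open>A repetition \<open>v a = v b\<close> gives the nontrivial relation with
      coefficient 1 at \<open>a\<close> and -1 at \<open>b\<close>.\<close>
    define c where "c j = (if j = a then 1 else 0) - (if j = b then 1 else 0 :: 'a)" for j
    have "(\<Sum>j\<in>UNIV. scale (c j) (v j)) =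
        (\<Sum>j\<in>UNIV. (if j = a then v j else 0) - (if j = b then v j else 0))"
      by (intro sum.cong) (auto simp: c_def)
    also have "\<dots> = 0"
      using ab by (simp add: sum_subtractf)
    finally have "c a = 0"
      using * by blast
    with ab show False
      by (simp add: c_def)
  qed
  show "independent (range v)"
  proof (rule independent_if_scalars_zero)
    fix f x
    assume "(\<Sum>x\<in>range v. scale (f x) x) = 0" and x: "x \<in> range v"
    then have "(\<Sum>j\<in>UNIV. scale (f (v j)) (v j)) = 0"
      using inj by (simp add: sum.reindex)
    then have "f (v j) = 0" for j
      using *[rule_format, of "\<lambda>j. f (v j)"] by blast
    then show "f x = 0"
      using x by auto
  qed simp
qed

section \<open>Generators of quotient spaces\<close>

text \<open>Taking residue classes is linear, so it carries spans to spans; each inclusion is an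
  induction on how an element is generated.\<close>

lemma quotient_span_residue_class:
  assumes W: "pol.subspace W"
  shows "quotient_span W (residue_class W ` Y) = residue_class W ` pol.span Y"
proof (intro equalityI subsetI)
  fix C
  assume "C \<in> quotient_span W (residue_class W ` Y)"
  then show "C \<in> residue_class W ` pol.span Y"
  proof induction
    case zero
    then show ?case
      using residue_class_zero pol.span_zero by blast
  next
    case (gen C)
    then show ?case
      using pol.span_base by blast
  next
    case (add C D)
    then show ?case
      using class_add_residue_class[OF W] pol.span_add by fastforce
  next
    case (scale C c)
    then show ?case
      using class_scale_residue_class[OF W] pol.span_scale by fastforce
  qed
next
  fix C
  assume "C \<in> residue_class W ` pol.span Y"
  then obtain p where p: "p \<in> pol.span Y" and C: "C = residue_class W p"
    by blast
  from p have "residue_class W p \<in> quotient_span W (residue_class W ` Y)"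
  proof (induction rule: pol.span_induct_alt)
    case base
    then show ?case
      by (simp add: residue_class_zero quotient_span.zero)
  next
    case (step c x y)
    have "class_add (class_scale W c (residue_class W x)) (residue_class W y)
        \<in> quotient_span W (residue_class W ` Y)"
      using step by (intro quotient_span.add quotient_span.scale) (auto intro: quotient_span.gen)
    then show ?case
      by (simp add: class_add_residue_class[OF W] class_scale_residue_class[OF W])
  qed
  then show "C \<in> quotient_span W (residue_class W ` Y)"
    by (simp add: C)
qed

text \<open>Since \<open>Y\<close> lies in \<open>V\<close>, only one inclusion is at stake, and the
  class of \<open>v\<close> is reached from \<open>y\<close> exactly when \<open>v - y\<close> lies
  in \<open>pol.span G\<close>. This turns (b) into a statement about spans of polynomials.\<close>

lemma quotient_span_eq_quotient_space_iff:
  fixes V :: "('n, 'k::field) pol set"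
  assumes "pol.subspace V" "Y \<subseteq> V"
  shows "quotient_span (pol.span G) (residue_class (pol.span G) ` Y) = quotient_space V (pol.span G)
    \<longleftrightarrow> V \<subseteq> pol.span (G \<union> Y)"
proof -
  have Y: "pol.span Y \<subseteq> V"
    using assms by (simp add: pol.span_minimal)
  let ?R = "residue_class (pol.span G)"
  have "?R ` pol.span Y = ?R ` V \<longleftrightarrow> ?R ` V \<subseteq> ?R ` pol.span Y"
    using image_mono[OF Y, of ?R] by auto
  also have "\<dots> \<longleftrightarrow> (\<forall>v\<in>V. \<exists>y\<in>pol.span Y. ?R v = ?R y)"
    by (simp only: image_subset_iff image_iff)
  also have "\<dots> \<longleftrightarrow> (\<forall>v\<in>V. \<exists>y\<in>pol.span Y. v - y \<in> pol.span G)"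
    by (simp only: residue_class_eq_iff[OF pol.subspace_span])
  also have "\<dots> \<longleftrightarrow> V \<subseteq> pol.span (G \<union> Y)"
  proof -
    have "v = x + y \<longleftrightarrow> v - y = x" for v x y :: "('n, 'k) pol"
      by (metis add_diff_cancel_right' diff_add_cancel)
    then have "v \<in> pol.span (G \<union> Y) \<longleftrightarrow> (\<exists>y\<in>pol.span Y. v - y \<in> pol.span G)" for v
      unfolding pol.span_Un mem_Collect_eq by metis
    then show ?thesis
      by blast
  qed
  finally show ?thesis
    by (simp add: quotient_span_residue_class quotient_space_def)
qed

section \<open>Indeterminates and their coefficients\<close>

definition var_term :: "'n \<Rightarrow> 'n power_product" where
  "var_term i = Poly_Mapping.single i 1"

lemma indet_eq: "indet i = Poly_Mapping.single (var_term i) 1"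
  by (simp add: indet_def var_term_def)

lemma lookup_var_term: "Poly_Mapping.lookup (var_term i) k = (if i = k then 1 else 0)"
  by (simp add: var_term_def lookup_single when_def)

lemma var_term_eq_iff [simp]: "var_term i = var_term j \<longleftrightarrow> i = j"
  by (metis lookup_var_term zero_neq_one)

lemma var_term_neq_0 [simp]: "var_term i \<noteq> 0"
  by (metis lookup_var_term lookup_zero zero_neq_one)

text \<open>An indeterminate is irreducible: its exponents are zero except for a single 1, which
  belongs entirely to one of the two factors.\<close>

lemma add_eq_var_term_iff:
  "t + u = var_term k \<longleftrightarrow> t = 0 \<and> u = var_term k \<or> t = var_term k \<and> u = 0"
proof
  assume eq: "t + u = var_term k"
  then have *: "Poly_Mapping.lookup t j + Poly_Mapping.lookup u j = (if k = j then 1 else 0)" for j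
    by (metis lookup_add lookup_var_term)
  have "t = 0" if "Poly_Mapping.lookup t k = 0"
  proof (rule poly_mapping_eqI)
    show "Poly_Mapping.lookup t j = Poly_Mapping.lookup 0 j" for j
      using *[of j] that by (cases "k = j") auto
  qed
  moreover have "u = 0" if "Poly_Mapping.lookup t k \<noteq> 0"
  proof (rule poly_mapping_eqI)
    show "Poly_Mapping.lookup u j = Poly_Mapping.lookup 0 j" for j
      using *[of j] that by (cases "k = j") auto
  qed
  ultimately show "t = 0 \<and> u = var_term k \<or> t = var_term k \<and> u = 0"
    using eq by (metis add_0 add.right_neutral)
qed auto

lemma add_var_term_neq_0 [simp]: "t + var_term k \<noteq> 0"
proof
  assume "t + var_term k = 0"
  then have "Poly_Mapping.lookup t k + Poly_Mapping.lookup (var_term k) k = 0"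
    by (metis lookup_add lookup_zero)
  then show False
    by (simp add: lookup_var_term)
qed

lemma lookup_pol_scale [simp]:
  "Poly_Mapping.lookup (pol_scale c p) t = c * Poly_Mapping.lookup p t"
  by (simp add: pol_scale_def flip: mult_map_scale_conv_mult) (simp add: map.rep_eq when_def)

lemma lookup_indet: "Poly_Mapping.lookup (indet i) t = (if t = var_term i then 1 else 0)"
  by (simp add: indet_eq lookup_single when_def eq_commute)

lemma sum_monomials:
  fixes p :: "'a \<Rightarrow>\<^sub>0 'b::comm_monoid_add"
  shows "(\<Sum>t\<in>Poly_Mapping.keys p. Poly_Mapping.single t (Poly_Mapping.lookup p t)) = p"
  by (rule poly_mapping_eqI) (auto simp: lookup_sum lookup_single when_def in_keys_iff)

lemma lookup_mult_indet:
  "Poly_Mapping.lookup (c * indet j) u =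
    (\<Sum>t\<in>Poly_Mapping.keys c. if t + var_term j = u then Poly_Mapping.lookup c t else 0)"
proof -
  have "c * indet j =
      (\<Sum>t\<in>Poly_Mapping.keys c. Poly_Mapping.single (t + var_term j) (Poly_Mapping.lookup c t))"
    by (subst (1) sum_monomials[of c, symmetric])
      (simp add: sum_distrib_right indet_eq mult_single)
  then show ?thesis
    by (simp add: lookup_sum lookup_single when_def)
qed

text \<open>A power product times \<open>x_j\<close> is an indeterminate only if that power product
  is 1, so only the constant coefficient of \<open>c\<close> contributes.\<close>

lemma lookup_mult_indet_var_term:
  "Poly_Mapping.lookup (c * indet j) (var_term k) =
    Poly_Mapping.lookup c 0 * Poly_Mapping.lookup (indet j) (var_term k)"
proof (cases "j = k")
  case True
  then show ?thesis
    by (auto simp: lookup_mult_indet lookup_indet add_eq_var_term_iff in_keys_iff)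
next
  case False
  then show ?thesis
    by (auto simp: lookup_mult_indet lookup_indet add_eq_var_term_iff)
qed

text \<open>Natural exponents with sum 1 have exactly one nonzero entry, a 1, so the power products
  of degree one are the indeterminates.\<close>

lemma homogeneous_component_1_eq_span:
  "homogeneous_component 1 = pol.span (range (indet :: 'n::finite \<Rightarrow> ('n, 'k::field) pol))"
proof (intro equalityI subsetI)
  fix p :: "('n, 'k) pol"
  assume p: "p \<in> homogeneous_component 1"
  have "Poly_Mapping.single t (Poly_Mapping.lookup p t) \<in> pol.span (range indet)"
    if t: "t \<in> Poly_Mapping.keys p" for t
  proof -
    have "(\<Sum>i\<in>UNIV. Poly_Mapping.lookup t i) = 1"
      using p t by (auto simp: homogeneous_component_def)
    then obtain i where "Poly_Mapping.lookup t i = 1" "\<And>j. i \<noteq> j \<Longrightarrow> Poly_Mapping.lookup t j = 0"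
      unfolding sum_eq_1_iff[OF finite] by blast
    then have "t = var_term i"
      by (auto intro!: poly_mapping_eqI simp: lookup_var_term)
    then have "Poly_Mapping.single t (Poly_Mapping.lookup p t)
        = pol_scale (Poly_Mapping.lookup p t) (indet i)"
      by (simp add: pol_scale_def indet_eq mult_single)
    then show ?thesis
      by (simp add: pol.span_scale pol.span_base)
  qed
  then show "p \<in> pol.span (range indet)"
    by (subst sum_monomials[of p, symmetric]) (rule pol.span_sum)
next
  fix p :: "('n, 'k) pol"
  assume "p \<in> pol.span (range indet)"
  then show "p \<in> homogeneous_component 1"
  proof (induction rule: pol.span_induct_alt)
    case base
    show ?case
      by (simp add: homogeneous_component_def)
  next
    case (step c x y)
    then obtain i where x: "x = indet i"
      by blast
    have "Poly_Mapping.keys (pol_scale c x + y) \<subseteq> insert (var_term i) (Poly_Mapping.keys y)"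
      by (auto simp: in_keys_iff lookup_add lookup_indet x split: if_splits)
    moreover have "(\<Sum>k\<in>UNIV. Poly_Mapping.lookup (var_term i) k) = 1"
      by (simp add: lookup_var_term)
    ultimately show ?case
      using step(2) by (auto simp: homogeneous_component_def)
  qed
qed

lemma keys_span_indet:
  assumes "p \<in> pol.span (indet ` T)"
  shows "Poly_Mapping.keys p \<subseteq> var_term ` T"
  using assms
proof (induction rule: pol.span_induct_alt)
  case (step c x y)
  then show ?case
    by (auto simp: in_keys_iff lookup_add lookup_indet split: if_splits)
qed simp

section \<open>Linear parts of elements of the ideal\<close>

text \<open>The homogeneous component of degree one, written out in the indeterminates so that it
  can be solved for one of them.\<close>

definition linear_part :: "('n::finite, 'k::field) pol \<Rightarrow> ('n, 'k) pol" where
  "linear_part f = (\<Sum>i\<in>UNIV. pol_scale (Poly_Mapping.lookup f (var_term i)) (indet i))"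

lemma linear_part_add: "linear_part (f + g) = linear_part f + linear_part g"
  by (simp add: linear_part_def lookup_add pol.scale_left_distrib sum.distrib)

text \<open>Multiplication by \<open>l\<close> raises degrees by one: the degree one part comes from
  the constant coefficient of \<open>c\<close> alone, and nothing is left in degree zero.\<close>

lemma linear_part_mult_linear_form:
  fixes a :: "'n::finite \<Rightarrow> 'k::field"
  defines "l \<equiv> \<Sum>j\<in>UNIV. pol_scale (a j) (indet j)"
  shows "linear_part (c * l) = pol_scale (Poly_Mapping.lookup c 0) l"
    and "Poly_Mapping.lookup (c * l) 0 = 0"
proof -
  have c: "c * l = (\<Sum>j\<in>UNIV. pol_scale (a j) (c * indet j))"
    unfolding l_def sum_distrib_left pol_scale_def by (simp only: mult.left_commute)
  have "Poly_Mapping.lookup (c * l) (var_term k) = Poly_Mapping.lookup c 0 * a k" for k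
    by (simp add: c lookup_sum lookup_mult_indet_var_term lookup_indet if_distrib cong: if_cong)
  then show "linear_part (c * l) = pol_scale (Poly_Mapping.lookup c 0) l"
    by (simp add: linear_part_def l_def pol.scale_sum_right)
  show "Poly_Mapping.lookup (c * l) 0 = 0"
    by (simp add: c lookup_sum lookup_mult_indet)
qed

text \<open>In a sum of terms \<open>c * L i\<close>, each summand has a scalar multiple of
  \<open>L i\<close> as its linear part and no constant term. This leads from the ideal back to the
  vector space spanned by the forms.\<close>

lemma ideal_span_linear_forms:
  fixes L :: "'r \<Rightarrow> ('n::finite, 'k::field) pol"
  assumes L: "\<And>i. L i = (\<Sum>j\<in>UNIV. pol_scale (a i j) (indet j))"
    and "f \<in> ideal.span (range L)"
  shows "linear_part f \<in> pol.span (range L) \<and> Poly_Mapping.lookup f 0 = 0"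
  using assms(2)
proof (induction rule: ideal.span_induct_alt)
  case base
  show ?case
    by (simp add: linear_part_def pol.span_zero)
next
  case (step c x y)
  then obtain i where x: "x = L i"
    by blast
  then have "linear_part (c * x) = pol_scale (Poly_Mapping.lookup c 0) x"
      "Poly_Mapping.lookup (c * x) 0 = 0"
    using linear_part_mult_linear_form[of c "a i"] by (simp_all flip: L)
  then show ?case
    using step x by (simp add: linear_part_add lookup_add pol.span_add pol.span_scale pol.span_base)
qed

section \<open>Monomial ideals, leading terms and term orderings\<close>

text \<open>Multiples of a monomial contain only multiples of its power product, and addition
  creates no new power products.\<close>

lemma keys_monomial_ideal:
  fixes p :: "('n, 'k::field) pol"
  assumes "p \<in> ideal.span {Poly_Mapping.single t 1 | t. t \<in> T}" and "u \<in> Poly_Mapping.keys p"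
  shows "\<exists>t\<in>T. \<exists>v. u = v + t"
  using assms
proof (induction arbitrary: u rule: ideal.span_induct_alt)
  case base
  then show ?case
    by simp
next
  case (step c x y)
  note IH = step(2) and u = step(3)
  from step obtain t where t: "t \<in> T" "x = Poly_Mapping.single t 1"
    by blast
  from u have "u \<in> Poly_Mapping.keys (c * x) \<or> u \<in> Poly_Mapping.keys y"
    using keys_add[of "c * x" y] by blast
  then show ?case
  proof
    assume "u \<in> Poly_Mapping.keys (c * x)"
    then show ?thesis
      using keys_mult[of c x] t by fastforce
  qed (rule IH)
qed

lemma leading_term_eqI:
  assumes "term_ordering \<sigma>" "t \<in> Poly_Mapping.keys f"
    and "\<And>u. u \<in> Poly_Mapping.keys f \<Longrightarrow> (u, t) \<in> \<sigma>"
  shows "leading_term \<sigma> f = t"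
proof -
  have "antisym \<sigma>"
    using assms(1)
    by (simp add: term_ordering_def linear_order_on_def partial_order_on_def)
  then show ?thesis
    unfolding leading_term_def using assms(2,3) by (intro the_equality) (auto dest: antisymD)
qed

text \<open>The support of \<open>f\<close> is finite and nonempty, so it has a greatest element for
  the linear order \<sigma>.\<close>

lemma leading_term_greatest:
  assumes \<sigma>: "term_ordering \<sigma>" and "f \<noteq> 0"
  shows "leading_term \<sigma> f \<in> Poly_Mapping.keys f"
    and "u \<in> Poly_Mapping.keys f \<Longrightarrow> (u, leading_term \<sigma> f) \<in> \<sigma>"
proof -
  have \<sigma>': "refl \<sigma>" "trans \<sigma>" "total \<sigma>"
    using \<sigma>
    by (auto simp: term_ordering_def linear_order_on_def partial_order_on_def preorder_on_def)
  have "\<exists>t\<in>K. \<forall>u\<in>K. (u, t) \<in> \<sigma>" if "finite K" "K \<noteq> {}" for K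
    using that
  proof (induction rule: finite_ne_induct)
    case (singleton x)
    then show ?case
      using \<sigma>' by (auto dest: refl_onD)
  next
    case (insert x K)
    then obtain t where t: "t \<in> K" "\<forall>u\<in>K. (u, t) \<in> \<sigma>"
      by blast
    have "(x, t) \<in> \<sigma> \<or> (t, x) \<in> \<sigma>" "(x, x) \<in> \<sigma>"
      using \<sigma>' by (metis UNIV_I refl_onD total_on_def)+
    then show ?case
      using t \<sigma>'(2) by (metis insert_iff transD)
  qed
  then obtain t where "t \<in> Poly_Mapping.keys f" "\<forall>u\<in>Poly_Mapping.keys f. (u, t) \<in> \<sigma>"
    using \<open>f \<noteq> 0\<close> by (metis finite_keys keys_eq_empty)
  moreover from this have "leading_term \<sigma> f = t"
    using leading_term_eqI[OF \<sigma>] by blast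
  ultimately show "leading_term \<sigma> f \<in> Poly_Mapping.keys f"
    and "u \<in> Poly_Mapping.keys f \<Longrightarrow> (u, leading_term \<sigma> f) \<in> \<sigma>"
    by auto
qed

text \<open>The lexicographic ordering works once the indeterminates of \<open>S\<close> are
  numbered before all others.\<close>

lemma elimination_ordering_exists:
  fixes S :: "'n::finite set"
  obtains \<sigma> where "term_ordering \<sigma>"
    and "\<And>k s. k \<notin> S \<Longrightarrow> s \<in> S \<Longrightarrow> (var_term k, var_term s) \<in> \<sigma>"
proof -
  obtain g :: "'n \<Rightarrow> nat" and N where g: "range g = {i. i < N}" "inj g"
    using finite_imp_inj_to_nat_seg[of "UNIV :: 'n set"] by auto
  \<comment> \<open>All values of \<open>g\<close> are below \<open>N\<close>, so the shift moves
    every index outside \<open>S\<close> behind those in \<open>S\<close>.\<close>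
  define r where "r k = (if k \<in> S then g k else g k + N)" for k
  have g_less: "g k < N" for k
    using g(1) by blast
  have r: "inj r"
  proof (rule injI)
    fix a b
    assume "r a = r b"
    then have "g a = g b"
      using g_less[of a] g_less[of b] by (auto simp: r_def split: if_splits)
    then show "a = b"
      using g(2) by (simp add: inj_eq)
  qed
  \<comment> \<open>The library orders \<open>nat power_product\<close> lexicographically, small indices first.\<close>
  define \<phi> :: "'n power_product \<Rightarrow> nat power_product"
    where "\<phi> t = (\<Sum>i\<in>UNIV. Poly_Mapping.single (r i) (Poly_Mapping.lookup t i))" for t
  have \<phi>_add: "\<phi> (t + u) = \<phi> t + \<phi> u" for t u
    by (simp add: \<phi>_def lookup_add single_add sum.distrib)
  have lookup_\<phi>: "Poly_Mapping.lookup (\<phi> t) (r i) = Poly_Mapping.lookup t i" for t i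
    using r by (simp add: \<phi>_def lookup_sum lookup_single when_def inj_eq)
  have \<phi>_inj: "t = u" if "\<phi> t = \<phi> u" for t u
    using that by (intro poly_mapping_eqI) (metis lookup_\<phi>)
  have \<phi>_var: "\<phi> (var_term i) = var_term (r i)" for i
  proof -
    have "\<phi> (var_term i) = (\<Sum>k\<in>UNIV. if i = k then var_term (r k) else 0)"
      unfolding \<phi>_def by (intro sum.cong) (auto simp: lookup_var_term var_term_def[of "r _"])
    then show ?thesis
      by simp
  qed
  \<comment> \<open>At the first position where \<open>p < 0\<close> differs from 0, a natural
    exponent would have to be negative.\<close>
  have nonneg: "0 \<le> p" for p :: "nat power_product"
  proof (rule ccontr)
    assume "\<not> 0 \<le> p"
    then have "p < 0"
      by simp
    then show False
      by (simp add: less_poly_mapping.rep_eq less_fun_def)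
  qed
  \<comment> \<open>The pullback along \<phi>: injectivity gives antisymmetry and additivity gives
    compatibility with multiplication.\<close>
  define \<sigma> where "\<sigma> = {(t, u). \<phi> t \<le> \<phi> u}"
  show thesis
  proof
    show "term_ordering \<sigma>"
      unfolding term_ordering_def linear_order_on_def partial_order_on_def preorder_on_def
      by (auto simp: \<sigma>_def refl_on_def trans_def antisym_def total_on_def \<phi>_add nonneg
          intro: \<phi>_inj add_right_mono) (simp add: \<phi>_def nonneg)
    fix k s
    assume "k \<notin> S" "s \<in> S"
    then have "r s < r k"
      using g_less[of s] by (simp add: r_def)
    \<comment> \<open>The first difference is at position \<open>r s\<close>, where the exponents
      are 0 and 1; the smaller index gives the larger indeterminate.\<close>
    then have "var_term (r k) < var_term (r s)"
      unfolding less_poly_mapping.rep_eq less_fun_def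
      by (intro exI[of _ "r s"]) (auto simp: lookup_var_term)
    then show "(var_term k, var_term s) \<in> \<sigma>"
      by (simp add: \<sigma>_def \<phi>_var)
  qed
qed

section \<open>Leading terms versus spans: (a) and (b)\<close>

text \<open>Induction over the indeterminates along \<sigma>: for \<open>i\<close> in
  \<open>S\<close>, an element of the ideal with leading term \<open>x_i\<close> has a linear part
  that expresses \<open>x_i\<close> modulo the forms by smaller indeterminates.\<close>

lemma span_if_leading_term_ideal:
  fixes L :: "'r \<Rightarrow> ('n::finite, 'k::field) pol"
  assumes L: "\<And>i. L i = (\<Sum>j\<in>UNIV. pol_scale (a i j) (indet j))"
    and \<sigma>: "term_ordering \<sigma>"
    and S: "\<And>i. i \<in> S \<Longrightarrow> indet i \<in> leading_term_ideal \<sigma> (ideal.span (range L))"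
  shows "indet i \<in> pol.span (range L \<union> indet ` (- S))"
proof -
  let ?T = "pol.span (range L \<union> indet ` (- S))"
  have \<sigma>': "trans \<sigma>" "antisym \<sigma>"
    using \<sigma>
    by (auto simp: term_ordering_def linear_order_on_def partial_order_on_def preorder_on_def)
  \<comment> \<open>Strict comparison of indeterminates is transitive and irreflexive on a finite
    set, hence well-founded.\<close>
  define R where "R = {(j, i). (var_term j, var_term i) \<in> \<sigma> \<and> j \<noteq> i}"
  have "trans R"
    using \<sigma>' unfolding R_def trans_def antisym_def
    by (safe, blast) (metis var_term_eq_iff)
  moreover have "irrefl R"
    by (simp add: R_def irrefl_def)
  ultimately have "wf R"
    by (intro finite_acyclic_wf) (auto simp: acyclic_irrefl)
  then show ?thesis
  proof (induction i)
    case (less i)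
    show ?case
    proof (cases "i \<in> S")
      case False
      then show ?thesis
        by (simp add: pol.span_base)
    next
      case True
      let ?LT = "{leading_term \<sigma> f | f. f \<in> ideal.span (range L) \<and> f \<noteq> 0}"
      have "leading_term_ideal \<sigma> (ideal.span (range L)) =
          ideal.span {Poly_Mapping.single t 1 | t. t \<in> ?LT}"
        unfolding leading_term_ideal_def by (rule arg_cong[of _ _ ideal.span]) blast
      then obtain t v where "t \<in> ?LT" and v: "var_term i = v + t"
        using keys_monomial_ideal[of "indet i :: ('n, 'k) pol" ?LT "var_term i"] S[OF True]
        by (auto simp: indet_eq)
      then obtain f where f: "f \<in> ideal.span (range L)" "f \<noteq> 0" "t = leading_term \<sigma> f"
        by blast
      have lin: "linear_part f \<in> pol.span (range L)" and "Poly_Mapping.lookup f 0 = 0"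
        using ideal_span_linear_forms[OF L f(1)] by auto
      \<comment> \<open>The leading term lies in the support of \<open>f\<close>, which does not
        contain 1. Being a divisor of \<open>x_i\<close> other than 1, it equals
        \<open>x_i\<close>.\<close>
      then have "t \<noteq> 0"
        using leading_term_greatest(1)[OF \<sigma> f(2)] f(3) by (auto simp: in_keys_iff)
      then have t: "leading_term \<sigma> f = var_term i"
        using v f(3) by (metis add_eq_var_term_iff)
      let ?c = "\<lambda>j. Poly_Mapping.lookup f (var_term j)"
      have ci: "?c i \<noteq> 0"
        using leading_term_greatest(1)[OF \<sigma> f(2)] t by (simp add: in_keys_iff)
      \<comment> \<open>An \<open>x_j\<close> that occurs in \<open>f\<close> is strictly below the
        leading term \<open>x_i\<close>, so the induction hypothesis covers it.\<close>
      have "pol_scale (?c j) (indet j) \<in> ?T" if "j \<noteq> i" for j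
      proof (cases "?c j = 0")
        case True
        then show ?thesis
          by (simp add: pol.span_zero)
      next
        case False
        then have "(j, i) \<in> R"
          using leading_term_greatest(2)[OF \<sigma> f(2), of "var_term j"] t that
          by (simp add: R_def in_keys_iff)
        then show ?thesis
          by (intro pol.span_scale less)
      qed
      then have "(\<Sum>j\<in>UNIV - {i}. pol_scale (?c j) (indet j)) \<in> ?T"
        by (intro pol.span_sum) auto
      moreover have "linear_part f \<in> ?T"
        using lin pol.span_mono[of "range L"] by blast
      moreover have "pol_scale (?c i) (indet i) =
          linear_part f - (\<Sum>j\<in>UNIV - {i}. pol_scale (?c j) (indet j))"
        unfolding linear_part_def by (subst sum.remove[of UNIV i]) auto
      ultimately have "pol_scale (?c i) (indet i) \<in> ?T"
        by (simp only: pol.span_diff)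
      then have "pol_scale (inverse (?c i)) (pol_scale (?c i) (indet i)) \<in> ?T"
        by (rule pol.span_scale)
      then show ?thesis
        using ci by simp
    qed
  qed
qed

text \<open>Write \<open>x_s = w + y\<close> with \<open>w\<close> in the span of the forms and
  \<open>y\<close> in that of the indeterminates outside \<open>S\<close>; then \<open>w\<close> is
  an element of the ideal with leading term \<open>x_s\<close>.\<close>

lemma leading_term_ideal_if_span:
  fixes L :: "'r \<Rightarrow> ('n::finite, 'k::field) pol"
  assumes \<sigma>: "term_ordering \<sigma>"
    and less: "\<And>k s. k \<notin> S \<Longrightarrow> s \<in> S \<Longrightarrow> (var_term k, var_term s) \<in> \<sigma>"
    and span: "indet s \<in> pol.span (range L \<union> indet ` (- S))" and s: "s \<in> S"
  shows "indet s \<in> leading_term_ideal \<sigma> (ideal.span (range L))"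
proof -
  obtain w y where w: "w \<in> pol.span (range L)" and y: "y \<in> pol.span (indet ` (- S))"
    and eq: "indet s = w + y"
    using span by (auto simp: pol.span_Un)
  have ys: "Poly_Mapping.keys y \<subseteq> var_term ` (- S)"
    by (rule keys_span_indet[OF y])
  have "w = indet s - y"
    by (simp add: eq)
  then have w_lookup: "Poly_Mapping.lookup w t =
      (if t = var_term s then 1 else 0) - Poly_Mapping.lookup y t" for t
    by (simp add: lookup_minus lookup_indet)
  \<comment> \<open>No cancellation: \<open>y\<close> does not involve \<open>x_s\<close>, so
    \<open>w\<close> keeps it with coefficient 1.\<close>
  have "Poly_Mapping.lookup y (var_term s) = 0"
    using ys s by (auto simp: in_keys_iff)
  then have s_key: "var_term s \<in> Poly_Mapping.keys w"
    by (simp add: in_keys_iff w_lookup)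
  have "refl \<sigma>"
    using \<sigma> by (auto simp: term_ordering_def linear_order_on_def partial_order_on_def preorder_on_def)
  then have "leading_term \<sigma> w = var_term s"
    using ys less s
    by (intro leading_term_eqI[OF \<sigma> s_key])
      (auto simp: in_keys_iff w_lookup refl_on_def split: if_splits)
  moreover have "w \<in> ideal.span (range L)"
    using w by (induction rule: pol.span_induct_alt)
      (auto simp: pol_scale_def intro: ideal.span_zero ideal.span_add ideal.span_scale ideal.span_base)
  moreover have "w \<noteq> 0"
    using s_key by auto
  ultimately show ?thesis
    unfolding leading_term_ideal_def indet_eq by (intro ideal.span_base) force
qed

section \<open>Linear functionals and columns: (b) and (c)\<close>

text \<open>A maximal independent subset of \<open>T\<close> stays independent when \<open>x\<close>
  is added, so values 0 on it and 1 at \<open>x\<close> can be prescribed and extended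
  linearly.\<close>

lemma separating_functional:
  assumes "x \<notin> pol.span T"
  obtains f where "Vector_Spaces.linear pol_scale (*) f" "\<And>t. t \<in> T \<Longrightarrow> f t = 0" "f x = 1"
proof -
  interpret functional: vector_space_pair pol_scale "(*)" ..
  obtain B where B: "B \<subseteq> T" "pol.independent B" "T \<subseteq> pol.span B"
    using pol.maximal_independent_subset by blast
  have "x \<notin> pol.span B"
    using assms pol.span_mono[OF B(1)] by blast
  then have "pol.independent (insert x B)"
    using B(2) by (rule pol.independent_insertI)
  then obtain f where f: "Vector_Spaces.linear pol_scale (*) f"
      "\<forall>b\<in>insert x B. f b = (if b = x then 1 else 0)"
    using functional.linear_independent_extend[of _ "\<lambda>b. if b = x then 1 else 0"] by blast
  interpret f: Vector_Spaces.linear pol_scale "(*)" f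
    by (rule f(1))
  have "f t = 0" if "t \<in> T" for t
  proof -
    have "t \<in> pol.span B"
      using that B by blast
    then show ?thesis
    proof (induction rule: pol.span_induct_alt)
      case (step c b y)
      moreover have "b \<noteq> x"
        using step(1) \<open>x \<notin> pol.span B\<close> pol.span_base by blast
      ultimately show ?case
        using f(2) by (simp add: f.add f.scale)
    qed (simp add: f.zero)
  qed
  then show thesis
    using that f by auto
qed

text \<open>On linear forms, a functional vanishing on the indeterminates outside
  \<open>range ind\<close> is given by its values \<open>c j\<close> at the others. It vanishes on
  every \<open>L i\<close> exactly when these values are the coefficients of a relation between the
  chosen columns.\<close>

lemma columns_independent_iff_span:
  fixes L :: "'r::finite \<Rightarrow> ('n::finite, 'k::field) pol" and ind :: "'s::finite \<Rightarrow> 'n"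
  assumes A: "is_coefficient_matrix A L" and ind: "inj ind"
  shows "inj (\<lambda>j. column (ind j) A) \<and> vec.independent (range (\<lambda>j. column (ind j) A))
    \<longleftrightarrow> (\<forall>i. indet i \<in> pol.span (range L \<union> indet ` (- range ind)))"
    (is "?indep \<longleftrightarrow> (\<forall>i. _ \<in> pol.span ?T)")
proof -
  have L: "L i = (\<Sum>j\<in>UNIV. pol_scale (A $ i $ j) (indet j))" for i
    using A by (simp add: is_coefficient_matrix_def)
  have dep: "(\<Sum>j\<in>UNIV. c j *s column (ind j) A) = 0 \<longleftrightarrow>
      (\<forall>i. (\<Sum>j\<in>UNIV. c j * A $ i $ ind j) = 0)" for c :: "'s \<Rightarrow> 'k"
    by (simp add: vec_eq_iff column_def)
  have "?indep \<longleftrightarrow> (\<forall>c. (\<forall>i. (\<Sum>j\<in>UNIV. c j * A $ i $ ind j) = 0) \<longrightarrow> (\<forall>j. c j = 0))"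
    unfolding vec.family_independent_iff dep ..
  also have "\<dots> \<longleftrightarrow> (\<forall>i. indet i \<in> pol.span ?T)"
  proof (intro iffI allI impI)
    fix i
    assume indep: "\<forall>c. (\<forall>i. (\<Sum>j\<in>UNIV. c j * A $ i $ ind j) = 0) \<longrightarrow> (\<forall>j. c j = 0)"
    show "indet i \<in> pol.span ?T"
    proof (rule ccontr)
      assume not_span: "indet i \<notin> pol.span ?T"
      then obtain f where "Vector_Spaces.linear pol_scale (*) f"
        and f0: "\<And>t. t \<in> ?T \<Longrightarrow> f t = 0" and f1: "f (indet i) = 1"
        using separating_functional by blast
      interpret f: Vector_Spaces.linear pol_scale "(*)" f
        by fact
      \<comment> \<open>Evaluating \<open>f\<close> at row \<open>m\<close> gives a column relation,
        since the indeterminates outside \<open>range ind\<close> contribute zero.\<close>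
      have "(\<Sum>j\<in>UNIV. f (indet (ind j)) * A $ m $ ind j) = 0" for m
      proof -
        have "0 = f (L m)"
          using f0 by simp
        also have "\<dots> = (\<Sum>k\<in>UNIV. A $ m $ k * f (indet k))"
          by (simp add: L f.sum f.scale)
        also have "\<dots> = (\<Sum>k\<in>range ind. A $ m $ k * f (indet k))"
          using f0 by (intro sum.mono_neutral_right) auto
        also have "\<dots> = (\<Sum>j\<in>UNIV. f (indet (ind j)) * A $ m $ ind j)"
          using ind by (simp add: sum.reindex mult.commute)
        finally show ?thesis ..
      qed
      then have zero: "f (indet (ind j)) = 0" for j
        using indep[rule_format, of "\<lambda>j. f (indet (ind j))"] by blast
      have "i \<in> range ind"
        using not_span pol.span_base[of "indet i" ?T] by blast
      then show False
        using zero f1 by auto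
    qed
  next
    fix c :: "'s \<Rightarrow> 'k" and j
    assume span: "\<forall>i. indet i \<in> pol.span ?T"
      and c: "\<forall>i. (\<Sum>j\<in>UNIV. c j * A $ i $ ind j) = 0"
    \<comment> \<open>Conversely, the column relation defines a functional reading only linear
      coefficients. It kills \<open>?T\<close>, hence every indeterminate, while its value at
      \<open>indet (ind j)\<close> is \<open>c j\<close>.\<close>
    define f where "f p = (\<Sum>j\<in>UNIV. c j * Poly_Mapping.lookup p (var_term (ind j)))"
      for p :: "('n, 'k) pol"
    have f_add: "f (p + q) = f p + f q" and f_scale: "f (pol_scale b p) = b * f p" for p q b
      by (simp_all add: f_def lookup_add sum.distrib sum_distrib_left distrib_left
          mult.left_commute del: ideal.scale_scale)
    have f_L: "f (L m) = 0" for m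
    proof -
      have "Poly_Mapping.lookup (L m) (var_term k) = A $ m $ k" for k
        by (simp add: L lookup_sum lookup_indet if_distrib cong: if_cong)
      then show ?thesis
        using c by (simp add: f_def)
    qed
    have f_Y: "f (indet k) = 0" if "k \<notin> range ind" for k
      using that by (auto simp: f_def lookup_indet intro!: sum.neutral)
    have "f p = 0" if "p \<in> pol.span ?T" for p
      using that
    proof (induction rule: pol.span_induct_alt)
      case base
      show ?case
        by (simp add: f_def)
    next
      case (step b x y)
      then have "f x = 0"
        using f_L f_Y by auto
      with step show ?case
        by (simp add: f_add f_scale)
    qed
    then have "f (indet (ind j)) = 0"
      using span by blast
    then show "c j = 0"
      using ind by (simp add: f_def lookup_indet inj_eq if_distrib cong: if_cong)
  qed
  finally show ?thesis .
qed

section \<open>Reduction of the three conditions to one span condition\<close>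

theorem proposition3p1:
  fixes L :: "'r::finite \<Rightarrow> ('n::finite, 'k::field) pol"
    and A :: "'k ^ 'n ^ 'r"
    and Z :: "'s::finite \<Rightarrow> ('n, 'k) pol"
    and Y :: "('n, 'k) pol set"
    and ind :: "'s \<Rightarrow> 'n"
  assumes "\<And>i. L i \<in> homogeneous_component 1"
    and "inj L" and "pol.independent (range L)"
    and "is_coefficient_matrix A L"
    and "CARD('s) \<le> CARD('r)"
    and "inj Z" and "\<And>j. Z j = indet (ind j)"
    and "Y = range indet - range Z"
  shows "((\<exists>\<sigma>. term_ordering \<sigma> \<and>
              ideal.span (range Z) \<subseteq> leading_term_ideal \<sigma> (ideal.span (range L)))
          \<longleftrightarrow>
          quotient_span (pol.span (range L)) (residue_class (pol.span (range L)) ` Y)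
            = quotient_space (homogeneous_component 1) (pol.span (range L)))
       \<and> (quotient_span (pol.span (range L)) (residue_class (pol.span (range L)) ` Y)
            = quotient_space (homogeneous_component 1) (pol.span (range L))
          \<longleftrightarrow>
          inj (\<lambda>j. column (ind j) A) \<and> vec.independent (range (\<lambda>j. column (ind j) A)))"
proof -
  let ?W = "pol.span (range L)"
  have L: "L i = (\<Sum>j\<in>UNIV. pol_scale (A $ i $ j) (indet j))" for i
    using assms(4) by (simp add: is_coefficient_matrix_def)
  have Z: "range Z = indet ` range ind"
    using assms(7) by auto
  have "inj (indet :: 'n \<Rightarrow> ('n, 'k) pol)"
    by (rule injI) (metis lookup_indet var_term_eq_iff zero_neq_one)
  \<comment> \<open>Injectivity of \<open>indet\<close> turns the complement of a set of
    indeterminates into the complement of their indices.\<close>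
  then have Y: "Y = indet ` (- range ind)"
    using assms(8) Z by (simp add: Compl_eq_Diff_UNIV image_set_diff)
  have ind: "inj ind"
    using assms(6,7) by (metis injD injI)
  have quotient: "quotient_span ?W (residue_class ?W ` Y)
        = quotient_space (homogeneous_component 1) ?W
      \<longleftrightarrow> (\<forall>i. indet i \<in> pol.span (range L \<union> indet ` (- range ind)))"
  proof -
    have "Y \<subseteq> homogeneous_component 1"
      unfolding Y homogeneous_component_1_eq_span using pol.span_base by blast
    moreover have "pol.subspace (homogeneous_component 1 :: ('n, 'k) pol set)"
      unfolding homogeneous_component_1_eq_span by (rule pol.subspace_span)
    ultimately have "quotient_span ?W (residue_class ?W ` Y)
          = quotient_space (homogeneous_component 1) ?W
        \<longleftrightarrow> homogeneous_component 1 \<subseteq> pol.span (range L \<union> Y)"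
      by (intro quotient_span_eq_quotient_space_iff)
    \<comment> \<open>A subspace contains the degree one component as soon as it contains its
      generators.\<close>
    also have "\<dots> \<longleftrightarrow> range indet \<subseteq> pol.span (range L \<union> Y)"
      unfolding homogeneous_component_1_eq_span
      by (meson order_trans pol.span_minimal pol.span_superset pol.subspace_span)
    finally show ?thesis
      by (auto simp: Y)
  qed
  have "(\<exists>\<sigma>. term_ordering \<sigma> \<and>
        ideal.span (range Z) \<subseteq> leading_term_ideal \<sigma> (ideal.span (range L)))
      \<longleftrightarrow> (\<forall>i. indet i \<in> pol.span (range L \<union> indet ` (- range ind)))"
  proof
    assume "\<exists>\<sigma>. term_ordering \<sigma> \<and>
      ideal.span (range Z) \<subseteq> leading_term_ideal \<sigma> (ideal.span (range L))"
    then obtain \<sigma> where \<sigma>: "term_ordering \<sigma>"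
        "ideal.span (range Z) \<subseteq> leading_term_ideal \<sigma> (ideal.span (range L))"
      by blast
    have "indet i \<in> leading_term_ideal \<sigma> (ideal.span (range L))" if "i \<in> range ind" for i
      using that \<sigma>(2) ideal.span_superset[of "range Z"] Z by blast
    then show "\<forall>i. indet i \<in> pol.span (range L \<union> indet ` (- range ind))"
      by (intro allI span_if_leading_term_ideal[OF L \<sigma>(1)])
  next
    assume span: "\<forall>i. indet i \<in> pol.span (range L \<union> indet ` (- range ind))"
    \<comment> \<open>This ordering depends only on the index set, so it serves all elements of
      \<open>Z\<close> at once.\<close>
    obtain \<sigma> where \<sigma>: "term_ordering \<sigma>"
        "\<And>k s. k \<notin> range ind \<Longrightarrow> s \<in> range ind \<Longrightarrow> (var_term k, var_term s) \<in> \<sigma>"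
      using elimination_ordering_exists[of "range ind"] by blast
    have "indet s \<in> leading_term_ideal \<sigma> (ideal.span (range L))" if "s \<in> range ind" for s
      using leading_term_ideal_if_span[OF \<sigma> span[rule_format] that] .
    then have "range Z \<subseteq> leading_term_ideal \<sigma> (ideal.span (range L))"
      unfolding Z by (rule image_subsetI)
    then have "ideal.span (range Z) \<subseteq> leading_term_ideal \<sigma> (ideal.span (range L))"
      unfolding leading_term_ideal_def by (rule ideal.span_minimal) (rule ideal.subspace_span)
    then show "\<exists>\<sigma>. term_ordering \<sigma> \<and>
        ideal.span (range Z) \<subseteq> leading_term_ideal \<sigma> (ideal.span (range L))"
      using \<sigma>(1) by blast
  qed
  then show ?thesis
    unfolding quotient columns_independent_iff_span[OF assms(4) ind] by blast
qed

end
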